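(* Let $(Q,\le,{}^*,0,1)$ be a pseudocomplemented poset satisfying the ascending chain condition. Then $(Q^*,\le)$ is a meet-semilattice if and only if there do not exist $a,d,f,g\in Q$ forming the following configuration: the eight elements $a^{**},g^*,f^*,d^{**},d^*,f^{**},g^{**},a^*$ are pairwise distinct and different from $0$ and $1$; $f^*$ and $g^*$ are maximal lower bounds of $\{a^*,d^*\}$ in $(Q^*,\le)$; the order induced on $\{0,1,a^{**},g^*,f^*,d^{**},d^*,f^{**},g^{**},a^*\}$ is the one generated by $0<a^{**},g^*,f^*,d^{**}<1$, $a^{**}<f^{**}$, $a^{**}<g^{**}$, $d^{**}<f^{**}$, $d^{**}<g^{**}$, $g^*<d^*$, $g^*<a^*$, $f^*<d^*$, $f^*<a^*$, $d^*,f^{**},g^{**},a^*<1$, together possibly with the relations $a^{**}<d^*$ and $d^{**}<a^*$ (which hold either both or neither) and possibly with $g^*<f^{**}$ and $f^*<g^{**}$ (which hold either both or neither), and no other strict comparabilities.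
   Context: A bounded poset $(Q,\le,0,1)$ is pseudocomplemented if for each $x\in Q$ there exists a greatest element $y\in Q$ such that the infimum $x\wedge y$ exists and equals $0$; it is denoted $x^*$. $Q^*:=\{x^*\mid x\in Q\}$ with the induced order. The ascending chain condition means every ascending chain in $(Q,\le)$ is eventually constant. *)

theory Defs
  imports Main "HOL-Library.Lub_Glb"
begin

(* The bounded poset Q is a whole type of sort {order_bot, order_top}, with 0 = bot and 1 = top.
   In isLb R S and isGlb R S the first argument R is the ambient (sub)poset. *)

definition pseudocomplementation :: "('a::{order_bot,order_top} \<Rightarrow> 'a) \<Rightarrow> bool" where
  "pseudocomplementation st \<longleftrightarrow> (\<forall>x. greatestP (\<lambda>y. isGlb UNIV {x, y} bot) (st x))"

definition ascending_chain_condition :: "'a::order itself \<Rightarrow> bool" where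
  "ascending_chain_condition _ \<longleftrightarrow>
     (\<forall>c :: nat \<Rightarrow> 'a. mono c \<longrightarrow> (\<exists>n. \<forall>m\<ge>n. c m = c n))"

definition meet_semilattice_on :: "'a::order set \<Rightarrow> bool" where
  "meet_semilattice_on P \<longleftrightarrow> (\<forall>x\<in>P. \<forall>y\<in>P. \<exists>z. isGlb P {x, y} z)"

definition maximal_lower_bound :: "'a::order set \<Rightarrow> 'a set \<Rightarrow> 'a \<Rightarrow> bool" where
  "maximal_lower_bound P S m \<longleftrightarrow> isLb P S m \<and> (\<forall>n. isLb P S n \<and> m \<le> n \<longrightarrow> n = m)"

definition strict_order_on :: "'a::order set \<Rightarrow> ('a \<times> 'a) set" where
  "strict_order_on S = {(x, y). x \<in> S \<and> y \<in> S \<and> x < y}"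

(* The Boolean p says whether the optional pair a** < d*, d** < a* is present,
   and q whether the optional pair g* < f**, f* < g** is. *)
definition config_generators ::
  "('a::{order_bot,order_top} \<Rightarrow> 'a) \<Rightarrow> bool \<Rightarrow> bool \<Rightarrow> 'a \<Rightarrow> 'a \<Rightarrow> 'a \<Rightarrow> 'a \<Rightarrow> ('a \<times> 'a) set" where
  "config_generators st p q a d f g =
     {bot} \<times> {st (st a), st g, st f, st (st d)} \<union>
     {st (st a), st g, st f, st (st d)} \<times> {top} \<union>
     {(st (st a), st (st f)), (st (st a), st (st g)),
      (st (st d), st (st f)), (st (st d), st (st g)),
      (st g, st d), (st g, st a), (st f, st d), (st f, st a)} \<union>
     {st d, st (st f), st (st g), st a} \<times> {top} \<union>
     (if p then {(st (st a), st d), (st (st d), st a)} else {}) \<union>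
     (if q then {(st g, st (st f)), (st f, st (st g))} else {})"

definition forbidden_configuration ::
  "('a::{order_bot,order_top} \<Rightarrow> 'a) \<Rightarrow> 'a \<Rightarrow> 'a \<Rightarrow> 'a \<Rightarrow> 'a \<Rightarrow> bool" where
  "forbidden_configuration st a d f g \<longleftrightarrow>
     (let E = [st (st a), st g, st f, st (st d), st d, st (st f), st (st g), st a] in
        distinct E \<and> bot \<notin> set E \<and> top \<notin> set E \<and>
        maximal_lower_bound (range st) {st a, st d} (st f) \<and>
        maximal_lower_bound (range st) {st a, st d} (st g) \<and>
        (\<exists>p q. strict_order_on ({bot, top} \<union> set E) = (config_generators st p q a d f g)\<^sup>+))"

end

theory Submission
  imports Defs
begin

text \<open>
  On \<open>Q\<^sup>*\<close> the map \<open>x \<mapsto> x\<^sup>*\<close> is an antitone involution, and \<open>x \<le> y\<^sup>*\<close> holds iff \<open>x\<close> and \<open>y\<close> have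
  no common lower bound except 0. If \<open>a\<^sup>*\<close> and \<open>d\<^sup>*\<close> have no infimum in \<open>Q\<^sup>*\<close>, the ascending chain
  condition yields two distinct maximal lower bounds \<open>f\<^sup>*\<close> and \<open>g\<^sup>*\<close>. Every comparability outside the
  configuration then either makes \<open>a\<^sup>*, d\<^sup>*\<close> or \<open>f\<^sup>*, g\<^sup>*\<close> comparable, or puts a nonzero element below
  both some \<open>x\<close> and \<open>x\<^sup>*\<close>. The optional relations come in pairs because \<open>\<^sup>*\<close> is antitone. Conversely,
  an infimum would have to equal each of two distinct maximal lower bounds.
\<close>

lemma isGlb_pair_bot_iff:
  fixes x y :: "'a::order_bot"
  shows "isGlb UNIV {x, y} bot \<longleftrightarrow> (\<forall>c. c \<le> x \<longrightarrow> c \<le> y \<longrightarrow> c = bot)"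
  by (auto simp: isGlb_def greatestP_def isLb_def setge_def setle_def intro: bot.extremum_uniqueI)

lemma isGlb_pair_iff:
  "isGlb P {x, y} z \<longleftrightarrow> z \<in> P \<and> z \<le> x \<and> z \<le> y \<and> (\<forall>c\<in>P. c \<le> x \<longrightarrow> c \<le> y \<longrightarrow> c \<le> z)"
  by (auto simp: isGlb_def greatestP_def isLb_def setge_def setle_def)

lemma maximal_lower_bound_pair_iff:
  "maximal_lower_bound P {x, y} m \<longleftrightarrow>
     m \<in> P \<and> m \<le> x \<and> m \<le> y \<and> (\<forall>n\<in>P. n \<le> x \<longrightarrow> n \<le> y \<longrightarrow> m \<le> n \<longrightarrow> n = m)"
  by (auto simp: maximal_lower_bound_def isLb_def setge_def)

lemma trans_strict_order_on: "trans (strict_order_on S)"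
  unfolding strict_order_on_def by (auto intro!: transI)

text \<open>The relation is the converse of \<open><\<close>, so its minimal elements are maximal in
  the order. An infinite descending sequence for it would be a strictly increasing chain.\<close>

lemma ascending_chain_condition_wf:
  assumes "ascending_chain_condition TYPE('a::order)"
  shows "wf {(y, x :: 'a). x < y}"
  unfolding wf_iff_no_infinite_down_chain
proof
  assume "\<exists>c. \<forall>i. (c (Suc i), c i) \<in> {(y, x :: 'a). x < y}"
  then obtain c :: "nat \<Rightarrow> 'a" where c: "\<And>i. c i < c (Suc i)" by auto
  then have "mono c" by (simp add: mono_iff_le_Suc less_imp_le)
  then obtain n where "\<forall>m\<ge>n. c m = c n"
    using assms unfolding ascending_chain_condition_def by blast
  then have "c (Suc n) = c n" by (meson le_SucI order_refl)
  with c[of n] show False by simp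
qed

text \<open>A maximal element of the lower bounds above \<open>z\<close> is maximal among all lower
  bounds, because anything above it is above \<open>z\<close> as well.\<close>

lemma exists_maximal_lower_bound_above:
  assumes "ascending_chain_condition TYPE('a::order)"
    and "(z :: 'a) \<in> P" "z \<le> x" "z \<le> y"
  obtains m where "maximal_lower_bound P {x, y} m" "z \<le> m"
proof -
  let ?S = "{u \<in> P. u \<le> x \<and> u \<le> y \<and> z \<le> u}"
  have "z \<in> ?S" using assms by simp
  with ascending_chain_condition_wf[OF assms(1)]
  have "\<exists>m\<in>?S. \<forall>u. (u, m) \<in> {(y, x). x < y} \<longrightarrow> u \<notin> ?S"
    unfolding wf_eq_minimal by (elim allE impE)
  then obtain m where m: "m \<in> ?S" and "\<forall>u. (u, m) \<in> {(y, x). x < y} \<longrightarrow> u \<notin> ?S" ..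
  then have max: "u \<notin> ?S" if "m < u" for u
    using that by simp
  have "n = m" if "n \<in> P" "n \<le> x" "n \<le> y" "m \<le> n" for n
  proof -
    have "n \<in> ?S" using that m by auto
    with max \<open>m \<le> n\<close> show ?thesis by (auto simp: le_less)
  qed
  with m show thesis
    by (intro that[of m]) (auto simp: maximal_lower_bound_pair_iff)
qed

context
  fixes st :: "'a::{order_bot,order_top} \<Rightarrow> 'a"
  assumes pc: "pseudocomplementation st"
begin

text \<open>The right-hand side is symmetric in \<open>x\<close> and \<open>y\<close>. This makes
  \<open>st\<close> an antitone Galois connection with itself, from which the rules below
  follow.\<close>

lemma le_st_iff: "x \<le> st y \<longleftrightarrow> (\<forall>c. c \<le> x \<longrightarrow> c \<le> y \<longrightarrow> c = bot)"
proof -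
  have "isGlb UNIV {y, st y} bot" and max: "isGlb UNIV {y, x} bot \<Longrightarrow> x \<le> st y"
    using pc unfolding pseudocomplementation_def greatestP_def setge_def setle_def by auto
  then show ?thesis unfolding isGlb_pair_bot_iff by (meson order_trans)
qed

lemma le_st_sym: "x \<le> st y \<longleftrightarrow> y \<le> st x"
  unfolding le_st_iff by blast

lemma le_st_st: "x \<le> st (st x)"
  using le_st_sym by blast

lemma st_antimono: "x \<le> y \<Longrightarrow> st y \<le> st x"
  using le_st_iff by (meson order_trans order_refl)

lemma st_st_st [simp]: "st (st (st x)) = st x"
  by (meson order_antisym le_st_st st_antimono)

lemma le_le_st_eq_bot: "c \<le> x \<Longrightarrow> c \<le> st x \<Longrightarrow> c = bot"
  using le_st_iff by blast

lemma bot_mem_range_st: "bot \<in> range st"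
proof -
  have "st top = bot" using le_le_st_eq_bot top_greatest by blast
  then show ?thesis by (metis rangeI)
qed

lemma st_le_st_iff_st_st: "st x \<le> st y \<longleftrightarrow> st (st y) \<le> st (st x)"
  by (metis st_antimono st_st_st)

lemma forbidden_configuration_if_maximal_lower_bounds:
  assumes f: "maximal_lower_bound (range st) {st a, st d} (st f)"
    and g: "maximal_lower_bound (range st) {st a, st d} (st g)"
    and "st f \<noteq> st g"
  shows "forbidden_configuration st a d f g"
proof -
  \<comment> \<open>\<open>st\<close> exchanges each letter with its primed version. The eight
    elements form a lower level \<open>A, G', F', D\<close> and an upper level
    \<open>D', F, G, A'\<close>.\<close>
  define A A' D D' where "A = st (st a)" and "A' = st a" and "D = st (st d)" and "D' = st d"
  define F F' G G' where "F = st (st f)" and "F' = st f" and "G = st (st g)" and "G' = st g"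
  note defs = A_def A'_def D_def D'_def F_def F'_def G_def G'_def
  have lower: "F' \<le> A'" "F' \<le> D'" "G' \<le> A'" "G' \<le> D'"
    using f g by (auto simp: maximal_lower_bound_pair_iff defs)
  then have upper: "A \<le> F" "D \<le> F" "A \<le> G" "D \<le> G"
    unfolding defs by (auto intro: st_antimono)
  have FG': "\<not> F' \<le> G'" "\<not> G' \<le> F'"
    using f g \<open>st f \<noteq> st g\<close> unfolding maximal_lower_bound_pair_iff defs by auto
  \<comment> \<open>If, say, \<open>A'\<close> were below \<open>D'\<close>, it would itself be a
    lower bound of the pair, and maximality would make both \<open>F'\<close> and \<open>G'\<close>
    equal to it.\<close>
  have AD': "\<not> A' \<le> D'" "\<not> D' \<le> A'"
    using f g \<open>st f \<noteq> st g\<close> unfolding maximal_lower_bound_pair_iff defs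
    by (metis order_refl rangeI)+
  have FG: "\<not> F \<le> G" "\<not> G \<le> F" and AD: "\<not> A \<le> D" "\<not> D \<le> A"
    using FG' AD' unfolding defs by (simp_all flip: st_le_st_iff_st_st)
  have nonbot: "A \<noteq> bot" "D \<noteq> bot" "F' \<noteq> bot" "G' \<noteq> bot"
    using FG' AD by auto
  have self: "\<not> A \<le> A'" "\<not> D \<le> D'" "\<not> F' \<le> F" "\<not> G' \<le> G"
    using nonbot le_le_st_eq_bot unfolding defs by (metis order_refl)+
  \<comment> \<open>\<open>F'\<close> lies below \<open>A'\<close>, and \<open>A\<close> is
    \<open>st A'\<close>; being below both would force \<open>F'\<close> to be
    \<open>bot\<close>.\<close>
  have low: "\<not> F' \<le> A" "\<not> F' \<le> D" "\<not> G' \<le> A" "\<not> G' \<le> D"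
    using nonbot lower le_le_st_eq_bot unfolding defs by metis+
  have low': "\<not> A \<le> F'" "\<not> A \<le> G'" "\<not> D \<le> F'" "\<not> D \<le> G'"
    using lower self by (meson order_trans)+
  have high: "\<not> A' \<le> F" "\<not> D' \<le> F" "\<not> A' \<le> G" "\<not> D' \<le> G"
    using lower self by (meson order_trans)+
  have high': "\<not> F \<le> A'" "\<not> F \<le> D'" "\<not> G \<le> A'" "\<not> G \<le> D'"
    using upper self by (meson order_trans)+
  \<comment> \<open>Each upper element is above both \<open>F'\<close> and \<open>G'\<close> or
    above both \<open>A\<close> and \<open>D\<close>; no lower element is.\<close>
  have down: "\<not> y \<le> x" if "x \<in> {A, G', F', D}" "y \<in> {D', F, G, A'}" for x y
  proof
    assume "y \<le> x"
    with that(2) lower upper have "F' \<le> x \<and> G' \<le> x \<or> A \<le> x \<and> D \<le> x"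
      by (elim insertE emptyE) (meson order_trans)+
    with that(1) low low' FG' AD show False by auto
  qed
  have p: "A \<le> D' \<longleftrightarrow> D \<le> A'" and q: "G' \<le> F \<longleftrightarrow> F' \<le> G"
    unfolding defs by (metis le_st_sym st_st_st)+
  have L1: "\<not> x < y" if "x \<in> {A, G', F', D}" "y \<in> {A, G', F', D}" for x y
    using that low low' FG' AD by (auto dest: less_imp_le)
  have L2: "\<not> x < y" if "x \<in> {D', F, G, A'}" "y \<in> {D', F, G, A'}" for x y
    using that high high' FG AD' by (auto dest: less_imp_le)
  have dist: "distinct [A, G', F', D, D', F, G, A']"
    using low' FG' AD high' FG AD' self down by auto
  have nb: "bot \<notin> {A, G', F', D, D', F, G, A'}"
    using nonbot FG AD' by auto
  have nt: "top \<notin> {A, G', F', D, D', F, G, A'}"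
    using FG' FG AD' AD by auto
  \<comment> \<open>The two Booleans are read off from the order itself; \<open>p\<close> and
    \<open>q\<close> ensure that each optional pair holds as a whole or not at all.\<close>
  let ?R = "config_generators st (A \<le> D') (G' \<le> F) a d f g"
  let ?S = "{bot, top} \<union> {A, G', F', D, D', F, G, A'}"
  have R: "?R = {bot} \<times> {A, G', F', D} \<union> {A, G', F', D} \<times> {top} \<union>
     {(A, F), (A, G), (D, F), (D, G), (G', D'), (G', A'), (F', D'), (F', A')} \<union>
     {D', F, G, A'} \<times> {top} \<union>
     (if A \<le> D' then {(A, D'), (D, A')} else {}) \<union> (if G' \<le> F then {(G', F), (F', G)} else {})"
    unfolding config_generators_def defs by simp
  have "strict_order_on ?S = ?R\<^sup>+"
  proof
    have bot1: "(bot, x) \<in> ?R" if "x \<in> {A, G', F', D}" for x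
      using that unfolding R by blast
    have top1: "(x, top) \<in> ?R" if "x \<in> {A, G', F', D} \<or> x \<in> {D', F, G, A'}" for x
      using that unfolding R by blast
    \<comment> \<open>No generator links \<open>bot\<close> to the upper level directly, so each
      upper element needs a lower one as intermediate step.\<close>
    have "(A, F) \<in> ?R" "(A, G) \<in> ?R" "(G', D') \<in> ?R" "(G', A') \<in> ?R"
      unfolding R by blast+
    then have bot2: "(bot, x) \<in> ?R\<^sup>+" if "x \<in> {D', F, G, A'}" for x
      using that bot1 by (blast intro: trancl_into_trancl)
    have bot_top: "(bot, top) \<in> ?R\<^sup>+"
      using bot1[of A] top1[of A] by (auto intro: trancl_into_trancl)
    \<comment> \<open>Of the sixteen pairs, eight are fixed generators, four are optional, and the
      four of the form \<open>x\<close>, \<open>st x\<close> are excluded by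
      \<open>self\<close>.\<close>
    have mid: "(x, y) \<in> ?R" if "x \<in> {A, G', F', D}" "y \<in> {D', F, G, A'}" "x < y" for x y
      using that(1,2) less_imp_le[OF that(3)] self p q
      unfolding R by (elim insertE emptyE; simp)
    show "strict_order_on ?S \<subseteq> ?R\<^sup>+"
    proof clarify
      fix x y assume "(x, y) \<in> strict_order_on ?S"
      then have "x < y" and xy: "x \<in> ?S" "y \<in> ?S" unfolding strict_order_on_def by auto
      from \<open>x < y\<close> have "x \<noteq> top" "y \<noteq> bot" by auto
      with xy have "x = bot \<or> x \<in> {A, G', F', D} \<or> x \<in> {D', F, G, A'}"
        "y = top \<or> y \<in> {A, G', F', D} \<or> y \<in> {D', F, G, A'}" by blast+
      then show "(x, y) \<in> ?R\<^sup>+"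
        using bot_top bot1 bot2 top1 mid L1 L2 down \<open>x < y\<close>
        by (metis less_imp_le trancl.r_into_trancl)
    qed
    have "?R \<subseteq> strict_order_on ?S"
    proof -
      have "\<And>x. x \<in> {A, G', F', D, D', F, G, A'} \<Longrightarrow> bot < x"
        "\<And>x. x \<in> {A, G', F', D, D', F, G, A'} \<Longrightarrow> x < top"
        using nb nt bot.not_eq_extremum top.not_eq_extremum by blast+
      moreover have "x < y" if "x \<in> {A, G', F', D}" "y \<in> {D', F, G, A'}" "x \<le> y" for x y
        using that down by (auto simp: less_le_not_le)
      ultimately show ?thesis
        using lower upper p q unfolding R strict_order_on_def by (auto split: if_splits)
    qed
    then have "?R\<^sup>+ \<subseteq> (strict_order_on ?S)\<^sup>+"
      by (rule trancl_mono_subset)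
    then show "?R\<^sup>+ \<subseteq> strict_order_on ?S"
      by (simp only: trancl_id[OF trans_strict_order_on])
  qed
  then have "\<exists>p q. strict_order_on ?S = (config_generators st p q a d f g)\<^sup>+" by blast
  with dist nb nt f g show ?thesis
    unfolding forbidden_configuration_def Let_def list.set defs by (intro conjI)
qed

end

theorem theorem8:
  fixes st :: "'a::{order_bot,order_top} \<Rightarrow> 'a"
  assumes "pseudocomplementation st"
    and "ascending_chain_condition TYPE('a)"
  shows "meet_semilattice_on (range st) \<longleftrightarrow> \<not> (\<exists>a d f g. forbidden_configuration st a d f g)"
proof
  assume semilattice: "meet_semilattice_on (range st)"
  show "\<not> (\<exists>a d f g. forbidden_configuration st a d f g)"
  proof
    assume "\<exists>a d f g. forbidden_configuration st a d f g"
    then obtain a d f g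
      where "maximal_lower_bound (range st) {st a, st d} (st f)"
        and "maximal_lower_bound (range st) {st a, st d} (st g)"
        and "st f \<noteq> st g"
      unfolding forbidden_configuration_def by (auto simp: Let_def)
    moreover obtain z where "isGlb (range st) {st a, st d} z"
      using semilattice unfolding meet_semilattice_on_def by blast
    ultimately show False
      unfolding isGlb_pair_iff maximal_lower_bound_pair_iff by metis
  qed
next
  assume no_config: "\<not> (\<exists>a d f g. forbidden_configuration st a d f g)"
  show "meet_semilattice_on (range st)"
    unfolding meet_semilattice_on_def
  proof (intro ballI)
    fix x y assume "x \<in> range st" "y \<in> range st"
    then obtain a d where xy: "x = st a" "y = st d" by blast
    obtain m where m: "maximal_lower_bound (range st) {x, y} m"
      using exists_maximal_lower_bound_above[OF assms(2) bot_mem_range_st[OF assms(1)]]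
        bot_least by blast
    \<comment> \<open>Any lower bound \<open>c\<close> lies below a maximal one \<open>n\<close>. If
      \<open>n\<close> differed from \<open>m\<close>, the two would yield a forbidden
      configuration, so \<open>m\<close> is the infimum.\<close>
    have "c \<le> m" if c: "c \<in> range st" "c \<le> x" "c \<le> y" for c
    proof -
      obtain n where n: "maximal_lower_bound (range st) {x, y} n" "c \<le> n"
        using exists_maximal_lower_bound_above[OF assms(2) c] .
      obtain f g where "m = st f" "n = st g"
        using m n unfolding maximal_lower_bound_pair_iff by blast
      then have "m = n"
        using no_config m n(1) forbidden_configuration_if_maximal_lower_bounds[OF assms(1)] xy
        by blast
      with n(2) show ?thesis by simp
    qed
    with m show "\<exists>z. isGlb (range st) {x, y} z"
      unfolding isGlb_pair_iff maximal_lower_bound_pair_iff by blast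
  qed
qed

end
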